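(* Suppose $q, n \in \mathbb{N}$ and $p$, $r$ are nonnegative integers satisfying $qn=q^{2}p+r$ where $p = \lfloor n/q \rfloor$. Then \[ P_{DP}(K_{2,n},q) = \sum_{i=1}^{q^{2}}(q-1)^{a_{i}}(q-2)^{n-a_{i}}, \] where, for each $j \in \{1,\dots,q^2\}$, \[ a_j=\begin{cases} p+1 & \text{if } j \leq r,\\ p & \text{if } j > r.\end{cases} \]
   Context: All graphs are finite and simple, and $\mathbb{N}=\{1,2,3,\dots\}$. The convention $0^0=1$ is used. $K_{2,n}$ is the complete bipartite graph with parts of sizes $2$ and $n$. For a graph $H$ and $S,U\subseteq V(H)$, $E_H(S,U)$ is the set of edges of $H$ with one endpoint in $S$ and the other in $U$. A cover of a graph $G$ is a pair $\mathcal{H}=(L,H)$ where $H$ is a graph and $L$ assigns to each $v\in V(G)$ a set $L(v)\subseteq V(H)$ such that: the sets $L(v)$, $v\in V(G)$, are pairwise disjoint, each $L(v)$ is an independent set in $H$, and $V(H)=\bigcup_{v\in V(G)}L(v)$; and for all distinct $u,v\in V(G)$, $E_H(L(u),L(v))$ is a matching (not necessarily perfect, possibly empty), which is empty whenever $uv\notin E(G)$. For $q\in\mathbb{N}$, the cover is $q$-fold if $|L(v)|=q$ for every $v\in V(G)$. A proper $\mathcal{H}$-coloring of $G$ is a set $T\subseteq V(H)$ with $|T\cap L(v)|=1$ for every $v\in V(G)$ that is independent in $H$. $P_{DP}(G,\mathcal{H})$ denotes the number of proper $\mathcal{H}$-colorings of $G$. The DP color function $P_{DP}(G,q)$ is the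 minimum of $P_{DP}(G,\mathcal{H})$ over all $q$-fold covers $\mathcal{H}$ of $G$. *)

theory Defs
  imports Complex_Main "Graph_Theory.Kuratowski"
begin

text \<open>
  A finite simple graph is a \<^locale>\<open>pair_graph\<close>: the edge \<open>xy\<close> is represented by the two arcs
  \<open>(x, y)\<close> and \<open>(y, x)\<close>. Sets of edges below consist of unordered pairs, so that an edge is not
  counted as two different members of a matching.
\<close>

definition edges_between :: "'b pair_pre_digraph \<Rightarrow> 'b set \<Rightarrow> 'b set \<Rightarrow> 'b set set" where
  "edges_between H S U = {{x, y} | x y. x \<in> S \<and> y \<in> U \<and> (x, y) \<in> parcs H}"

definition indep_set :: "'b pair_pre_digraph \<Rightarrow> 'b set \<Rightarrow> bool" where
  "indep_set H S \<longleftrightarrow> S \<subseteq> pverts H \<and> (\<forall>x\<in>S. \<forall>y\<in>S. (x, y) \<notin> parcs H)"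

definition matching :: "'b set set \<Rightarrow> bool" where
  "matching M \<longleftrightarrow> pairwise disjnt M"

text \<open>Only the values of \<open>L\<close> on the vertices of \<open>G\<close> are relevant.\<close>

definition dp_cover ::
  "'a pair_pre_digraph \<Rightarrow> ('a \<Rightarrow> 'b set) \<Rightarrow> 'b pair_pre_digraph \<Rightarrow> bool" where
  "dp_cover G L H \<longleftrightarrow>
     pair_graph H \<and>
     disjoint_family_on L (pverts G) \<and>
     (\<forall>v\<in>pverts G. indep_set H (L v)) \<and>
     pverts H = (\<Union>v\<in>pverts G. L v) \<and>
     (\<forall>u\<in>pverts G. \<forall>v\<in>pverts G. u \<noteq> v \<longrightarrow>
        matching (edges_between H (L u) (L v)) \<and>
        ((u, v) \<notin> parcs G \<longrightarrow> edges_between H (L u) (L v) = {}))"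

definition dp_fold_cover ::
  "nat \<Rightarrow> 'a pair_pre_digraph \<Rightarrow> ('a \<Rightarrow> 'b set) \<Rightarrow> 'b pair_pre_digraph \<Rightarrow> bool" where
  "dp_fold_cover q G L H \<longleftrightarrow>
     dp_cover G L H \<and> (\<forall>v\<in>pverts G. finite (L v) \<and> card (L v) = q)"

definition dp_colorings ::
  "'a pair_pre_digraph \<Rightarrow> ('a \<Rightarrow> 'b set) \<Rightarrow> 'b pair_pre_digraph \<Rightarrow> 'b set set" where
  "dp_colorings G L H =
     {T. T \<subseteq> pverts H \<and> (\<forall>v\<in>pverts G. card (T \<inter> L v) = 1) \<and> indep_set H T}"

definition num_dp_colorings ::
  "'a pair_pre_digraph \<Rightarrow> ('a \<Rightarrow> 'b set) \<Rightarrow> 'b pair_pre_digraph \<Rightarrow> nat" where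
  "num_dp_colorings G L H = card (dp_colorings G L H)"

text \<open>
  The covering graphs \<open>H\<close> have vertices of type \<^typ>\<open>nat\<close>. This is no restriction, as every finite
  graph is isomorphic to one of these: \<open>dp_color_function_le\<close> below shows that the value is a lower
  bound for covers over every vertex type, and \<open>dp_color_function_attained\<close> that it is a minimum.
\<close>

definition dp_color_function :: "'a pair_pre_digraph \<Rightarrow> nat \<Rightarrow> nat" where
  "dp_color_function G q =
     Inf {num_dp_colorings G L H | (L :: 'a \<Rightarrow> nat set) H. dp_fold_cover q G L H}"

lemma dp_cover_nat_copy:
  fixes L :: "'a \<Rightarrow> 'b set"
  assumes "dp_fold_cover q G L H"
  obtains L' :: "'a \<Rightarrow> nat set" and H'
  where "dp_fold_cover q G L' H'" "num_dp_colorings G L' H' = num_dp_colorings G L H"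
proof -
  let ?V = "pverts H" and ?A = "parcs H"
  have c: "dp_cover G L H" and fin: "\<And>v. v \<in> pverts G \<Longrightarrow> finite (L v) \<and> card (L v) = q"
    using assms by (auto simp: dp_fold_cover_def)
  interpret H: pair_graph H using c by (simp add: dp_cover_def)
  have V: "?V = (\<Union>v\<in>pverts G. L v)" and disj: "disjoint_family_on L (pverts G)"
    and ind: "\<And>v. v \<in> pverts G \<Longrightarrow> indep_set H (L v)"
    and mat: "\<And>u v. u \<in> pverts G \<Longrightarrow> v \<in> pverts G \<Longrightarrow> u \<noteq> v \<Longrightarrow>
        matching (edges_between H (L u) (L v)) \<and>
        ((u, v) \<notin> parcs G \<longrightarrow> edges_between H (L u) (L v) = {})"
    using c unfolding dp_cover_def by blast+
  obtain f :: "'b \<Rightarrow> nat" where f: "inj_on f ?V"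
    using finite_imp_inj_to_nat_seg[OF H.pair_finite_verts] by metis
  define H' where "H' = \<lparr>pverts = f ` ?V, parcs = map_prod f f ` ?A\<rparr>"
  define L' where "L' = (\<lambda>v. f ` L v)"
  have AV: "x \<in> ?V" "y \<in> ?V" if "(x, y) \<in> ?A" for x y
    using that by (rule H.in_arcsD1, rule H.in_arcsD2)
  have LV: "L v \<subseteq> ?V" if "v \<in> pverts G" for v using that V by auto
  have arc: "(f x, f y) \<in> parcs H' \<longleftrightarrow> (x, y) \<in> ?A" if xy: "x \<in> ?V" "y \<in> ?V" for x y
  proof
    assume "(f x, f y) \<in> parcs H'"
    then obtain u v where uv: "(u, v) \<in> ?A" "f u = f x" "f v = f y" by (auto simp: H'_def)
    have "u = x" by (rule inj_onD[OF f uv(2) AV(1)[OF uv(1)] xy(1)])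
    moreover have "v = y" by (rule inj_onD[OF f uv(3) AV(2)[OF uv(1)] xy(2)])
    ultimately show "(x, y) \<in> ?A" using uv(1) by simp
  next
    assume "(x, y) \<in> ?A"
    then have "map_prod f f (x, y) \<in> map_prod f f ` ?A" by (rule imageI)
    then show "(f x, f y) \<in> parcs H'" by (simp add: H'_def)
  qed
  have indiff: "indep_set H' (f ` S) \<longleftrightarrow> indep_set H S" if "S \<subseteq> ?V" for S
    using that arc by (auto simp: indep_set_def H'_def subset_iff)
  have eb: "edges_between H' (f ` S) (f ` U) = (image f) ` edges_between H S U"
    if "S \<subseteq> ?V" "U \<subseteq> ?V" for S U
  proof (intro set_eqI iffI)
    fix e assume "e \<in> edges_between H' (f ` S) (f ` U)"
    then obtain x y where xy: "e = {f x, f y}" "x \<in> S" "y \<in> U" "(f x, f y) \<in> parcs H'"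
      unfolding edges_between_def by blast
    then have "(x, y) \<in> ?A" using arc that by blast
    with xy show "e \<in> (image f) ` edges_between H S U"
      by (intro image_eqI[of _ _ "{x, y}"]) (auto simp: edges_between_def)
  next
    fix e assume "e \<in> (image f) ` edges_between H S U"
    then obtain x y where xy: "e = {f x, f y}" "x \<in> S" "y \<in> U" "(x, y) \<in> ?A"
      by (auto simp: edges_between_def)
    then have "(f x, f y) \<in> parcs H'" using arc that by blast
    then show "e \<in> edges_between H' (f ` S) (f ` U)"
      using xy unfolding edges_between_def by blast
  qed
  have ebV: "e \<subseteq> ?V" if "e \<in> edges_between H S U" for e S U
    using that AV by (auto simp: edges_between_def)
  have mat': "matching ((image f) ` M)" if "matching M" "\<And>e. e \<in> M \<Longrightarrow> e \<subseteq> ?V" for M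
  proof -
    have "disjnt (f ` d) (f ` e)" if "d \<in> M" "e \<in> M" "f ` d \<noteq> f ` e" for d e
    proof -
      have "disjnt d e" using that \<open>matching M\<close> by (auto simp: matching_def pairwise_def)
      then have "f ` d \<inter> f ` e = {}"
        using inj_on_image_Int[OF f, of d e] that \<open>\<And>e. e \<in> M \<Longrightarrow> e \<subseteq> ?V\<close>
        by (auto simp: disjnt_def)
      then show ?thesis by (simp add: disjnt_def)
    qed
    then show ?thesis by (auto simp: matching_def pairwise_def)
  qed
  have gr: "pair_graph H'"
  proof (unfold_locales)
    have "sym ?A" using H.pair_sym_arcs by (simp add: symmetric_def)
    then show "symmetric (with_proj H')"
      unfolding symmetric_def with_proj_simps H'_def sym_def by auto
    fix e assume "e \<in> parcs H'"
    then obtain x y where xy: "e = (f x, f y)" "(x, y) \<in> ?A" by (auto simp: H'_def)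
    then have "x \<noteq> y" using H.pair_no_loops by fastforce
    then show "fst e \<noteq> snd e" using AV[OF xy(2)] inj_onD[OF f, of x y] xy(1) by auto
    show "fst e \<in> pverts H'" "snd e \<in> pverts H'"
      using AV[OF xy(2)] by (simp_all add: xy(1) H'_def)
  qed (simp_all add: H'_def H.pair_finite_verts H.pair_finite_arcs)
  have "dp_cover G L' H'"
    unfolding dp_cover_def
  proof (intro conjI ballI impI gr)
    show "disjoint_family_on L' (pverts G)"
      unfolding disjoint_family_on_def L'_def
    proof (intro ballI impI)
      fix u v assume uv: "u \<in> pverts G" "v \<in> pverts G" "u \<noteq> v"
      then have "L u \<inter> L v = {}" using disj by (auto simp: disjoint_family_on_def)
      then show "f ` L u \<inter> f ` L v = {}"
        using inj_on_image_Int[OF f LV LV, OF uv(1,2)] by simp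
    qed
    show "pverts H' = (\<Union>v\<in>pverts G. L' v)" by (auto simp: H'_def L'_def V)
    show "indep_set H' (L' v)" if "v \<in> pverts G" for v
      using that ind indiff LV by (simp add: L'_def)
    fix u v assume uv: "u \<in> pverts G" "v \<in> pverts G" "u \<noteq> v"
    show "matching (edges_between H' (L' u) (L' v))"
      using mat[OF uv] eb[OF LV LV, OF uv(1,2)] mat' ebV by (simp add: L'_def)
    show "edges_between H' (L' u) (L' v) = {}" if "(u, v) \<notin> parcs G"
      using mat[OF uv] that eb[OF LV LV, OF uv(1,2)] by (simp add: L'_def)
  qed
  moreover have "finite (L' v) \<and> card (L' v) = q" if "v \<in> pverts G" for v
    using fin[OF that] card_image[OF inj_on_subset[OF f LV[OF that]]] by (simp add: L'_def)
  ultimately have 1: "dp_fold_cover q G L' H'" by (simp add: dp_fold_cover_def)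
  have cd: "card (f ` T \<inter> L' v) = card (T \<inter> L v)" if "T \<subseteq> ?V" "v \<in> pverts G" for T v
  proof -
    have "f ` T \<inter> f ` L v = f ` (T \<inter> L v)"
      using inj_on_image_Int[OF f that(1) LV[OF that(2)]] by simp
    moreover have "inj_on f (T \<inter> L v)" using that f by (meson inf.coboundedI1 inj_on_subset)
    ultimately show ?thesis by (simp add: card_image L'_def)
  qed
  have "dp_colorings G L' H' = (image f) ` dp_colorings G L H"
  proof (intro set_eqI iffI)
    fix S assume S: "S \<in> dp_colorings G L' H'"
    then obtain T where T: "S = f ` T" "T \<subseteq> ?V"
      by (auto simp: dp_colorings_def H'_def subset_image_iff)
    then have "T \<in> dp_colorings G L H"
      using S cd indiff by (auto simp: dp_colorings_def)
    then show "S \<in> (image f) ` dp_colorings G L H" using T by blast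
  next
    fix S assume "S \<in> (image f) ` dp_colorings G L H"
    then obtain T where "S = f ` T" "T \<in> dp_colorings G L H" by blast
    then show "S \<in> dp_colorings G L' H'"
      using cd indiff by (auto simp: dp_colorings_def H'_def)
  qed
  moreover have "inj_on (image f) (dp_colorings G L H)"
    by (rule inj_on_subset[OF inj_on_image_Pow[OF f]]) (auto simp: dp_colorings_def)
  ultimately have "num_dp_colorings G L' H' = num_dp_colorings G L H"
    by (simp add: num_dp_colorings_def card_image)
  with 1 show thesis by (rule that)
qed

lemma dp_color_function_le:
  fixes L :: "'a \<Rightarrow> 'b set"
  assumes "dp_fold_cover q G L H"
  shows "dp_color_function G q \<le> num_dp_colorings G L H"
proof -
  obtain L' :: "'a \<Rightarrow> nat set" and H'
    where "dp_fold_cover q G L' H'" "num_dp_colorings G L' H' = num_dp_colorings G L H"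
    using assms by (rule dp_cover_nat_copy)
  then show ?thesis
    unfolding dp_color_function_def by (metis (mono_tags, lifting) mem_Collect_eq wellorder_Inf_le1)
qed

lemma dp_color_function_attained:
  fixes G :: "'a pair_pre_digraph"
  assumes "pair_graph G"
  obtains L :: "'a \<Rightarrow> nat set" and H
  where "dp_fold_cover q G L H" "dp_color_function G q = num_dp_colorings G L H"
proof -
  interpret pair_graph G by fact
  define H where "H = \<lparr>pverts = pverts G \<times> {..<q}, parcs = {}\<rparr>"
  define L where "L = (\<lambda>v :: 'a. {v} \<times> {..<q})"
  have "pair_graph H"
    by unfold_locales (auto simp: H_def symmetric_def sym_def)
  then have "dp_fold_cover q G L H"
    by (auto simp: dp_fold_cover_def dp_cover_def H_def L_def indep_set_def edges_between_def
        matching_def disjoint_family_on_def)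
  then obtain L' :: "'a \<Rightarrow> nat set" and H' where "dp_fold_cover q G L' H'"
    by (rule dp_cover_nat_copy)
  then have "{num_dp_colorings G L H | (L :: 'a \<Rightarrow> nat set) H. dp_fold_cover q G L H} \<noteq> {}"
    by blast
  from Inf_nat_def1[OF this] show thesis
    using that unfolding dp_color_function_def by auto
qed

end

theory Submission
  imports Defs "HOL-Library.FuncSet"
begin

text \<open>
  Let \<open>u\<close>, \<open>v\<close> be the two vertices on the small side of \<open>K\<^bsub>2,n\<^esub>\<close>, and \<open>Y\<close> the other side. Since \<open>Y\<close> is
  independent, a coloring of a \<open>q\<close>-fold cover is a choice of \<open>s \<in> L u\<close> and \<open>t \<in> L v\<close> followed by an
  independent choice, for each \<open>y \<in> Y\<close>, of a color in \<open>L y\<close> adjacent to neither \<open>s\<close> nor \<open>t\<close>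
  (\<open>num_dp_colorings_2_n\<close>). Extending the matchings to bijections \<open>g y : L u \<rightarrow> L y\<close> and
  \<open>h y : L v \<rightarrow> L y\<close> only removes colorings; after that, \<open>y\<close> has \<open>q - 1\<close> colors left if
  \<open>g y s = h y t\<close> and \<open>q - 2\<close> otherwise. So if \<open>c s t\<close> is the number of \<open>y\<close> with \<open>g y s = h y t\<close>, the
  pair \<open>(s, t)\<close> contributes \<open>F (c s t)\<close>, where \<open>F k = (q - 1)\<^sup>k (q - 2)\<^bsup>n - k\<^esup>\<close>.

  For each \<open>y\<close> exactly \<open>q\<close> pairs satisfy \<open>g y s = h y t\<close>, so the \<open>q\<^sup>2\<close> numbers \<open>c s t\<close> add up to
  \<open>q n = q\<^sup>2 p + r\<close> for all choices of the bijections (\<open>sum_agreements\<close>). For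
  \<open>q \<ge> 2\<close> the sequence \<open>F\<close> is convex, so it lies above the line through \<open>(p, F p)\<close> and \<open>(p + 1, F (p + 1))\<close>; summing this line over all pairs gives
  the lower bound \<open>q\<^sup>2 F p + r (F (p + 1) - F p)\<close>. The line agrees with \<open>F\<close> at \<open>p\<close> and \<open>p + 1\<close>,
  so the bound is attained by each cover with perfect matchings for which all \<open>c s t\<close> are \<open>p\<close> or
  \<open>p + 1\<close>. Such a cover arises when \<open>g y\<close> is the identity and \<open>h y\<close> is the
  rotation of \<open>\<int>/q\<close> by the index of \<open>y\<close>: then \<open>c s t\<close> counts the indices below \<open>n\<close> in a residue class mod \<open>q\<close>. The numbers \<open>a\<^sub>i\<close> also
  take only the values \<open>p\<close> and \<open>p + 1\<close> and have the same sum, so the formula in the theorem has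
  this same value. For \<open>q = 1\<close> the bound is \<open>0\<close>.
\<close>

section \<open>Sums over balanced families and convex sequences\<close>

text \<open>
  On the two points \<open>p\<close> and \<open>p + 1\<close> every function is affine, so the sum depends only on the
  total of the \<open>c i\<close>. This evaluates both the coloring count of the extremal cover and the sum
  in the theorem.
\<close>

lemma sum_of_two_consecutive_values:
  fixes F :: "nat \<Rightarrow> int" and c :: "'i \<Rightarrow> nat"
  assumes "finite I" "\<And>i. i \<in> I \<Longrightarrow> c i = p \<or> c i = p + 1" "(\<Sum>i\<in>I. c i) = card I * p + r"
  shows "(\<Sum>i\<in>I. F (c i)) = int (card I) * F p + int r * (F (p + 1) - F p)"
proof -
  have "(\<Sum>i\<in>I. F (c i)) = (\<Sum>i\<in>I. F p + (int (c i) - int p) * (F (p + 1) - F p))"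
    using assms(2) by (intro sum.cong) (auto dest!: assms(2))
  also have "\<dots> = int (card I) * F p + (int (\<Sum>i\<in>I. c i) - int (card I) * int p) * (F (p + 1) - F p)"
    by (simp add: sum.distrib sum_subtractf flip: sum_distrib_right)
  finally show ?thesis unfolding assms(3) by simp
qed

lemma convex_sequence_above_tangent:
  fixes F :: "nat \<Rightarrow> int"
  assumes conv: "\<And>k. k + 2 \<le> n \<Longrightarrow> F (k + 1) - F k \<le> F (k + 2) - F (k + 1)"
    and "p < n" "k \<le> n"
  shows "F p + (int k - int p) * (F (p + 1) - F p) \<le> F k"
proof -
  have mono: "F (i + 1) - F i \<le> F (j + 1) - F j" if "i \<le> j" "j < n" for i j
    using that
  proof (induction j rule: dec_induct)
    case (step m)
    then show ?case using conv[of m] by simp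
  qed simp
  show ?thesis
  proof (cases "p \<le> k")
    case True
    then show ?thesis using \<open>k \<le> n\<close>
    proof (induction k rule: dec_induct)
      case (step m)
      then show ?case using mono[of p m] by (simp add: algebra_simps)
    qed simp
  next
    case False
    then have "k \<le> p" by simp
    then show ?thesis
    proof (induction k rule: inc_induct)
      case (step m)
      then show ?case using mono[of m p] \<open>p < n\<close> by (simp add: algebra_simps)
    qed simp
  qed
qed

text \<open>
  The second difference is \<open>(x + 1)\<^sup>k x\<^sup>m ((x + 1) - x)\<^sup>2\<close> with \<open>m = n - k - 2\<close>.
\<close>

lemma power_split_convex:
  fixes x :: int
  assumes "x \<ge> 0" "k + 2 \<le> n"
  defines "F \<equiv> \<lambda>k. (x + 1) ^ k * x ^ (n - k)"
  shows "F (k + 1) - F k \<le> F (k + 2) - F (k + 1)"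
proof -
  obtain m where n: "n = k + 2 + m" using assms(2) le_Suc_ex by blast
  have "F (k + 2) - F (k + 1) - (F (k + 1) - F k) = (x + 1) ^ k * x ^ m"
    by (simp add: F_def n algebra_simps power2_eq_square)
  moreover have "(x + 1) ^ k * x ^ m \<ge> 0" using assms(1) by simp
  ultimately show ?thesis by linarith
qed

section \<open>Matchings and residue classes\<close>

lemma matching_extends_to_bij:
  assumes "finite A" "finite B" "card A = card B" "M \<subseteq> A \<times> B"
    and "single_valued M" "single_valued (M\<inverse>)"
  obtains g where "bij_betw g A B" "\<And>a b. (a, b) \<in> M \<Longrightarrow> g a = b"
proof -
  define f where "f = (\<lambda>a. THE b. (a, b) \<in> M)"
  have f: "f a = b" if "(a, b) \<in> M" for a b
    using that assms(5) unfolding f_def single_valued_def by blast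
  have D: "Domain M \<subseteq> A" and R: "Range M \<subseteq> B" using assms(4) by auto
  have 1: "bij_betw f (Domain M) (Range M)"
    unfolding bij_betw_def
  proof
    show "inj_on f (Domain M)"
      using assms(6) f by (auto simp: inj_on_def single_valued_def)
    show "f ` Domain M = Range M"
    proof (intro equalityI subsetI)
      fix b assume "b \<in> Range M"
      then obtain a where "(a, b) \<in> M" by blast
      then show "b \<in> f ` Domain M" using f by blast
    qed (use f in auto)
  qed
  have "card (A - Domain M) = card (B - Range M)"
    using assms(1-3) D R bij_betw_same_card[OF 1] finite_subset
    by (metis card_Diff_subset)
  then obtain h where 2: "bij_betw h (A - Domain M) (B - Range M)"
    using assms(1,2) finite_same_card_bij by blast
  define g where "g = (\<lambda>a. if a \<in> Domain M then f a else h a)"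
  have "bij_betw g (Domain M) (Range M)"
    using 1 by (rule bij_betw_cong[THEN iffD1, rotated]) (simp add: g_def)
  moreover have "bij_betw g (A - Domain M) (B - Range M)"
    using 2 by (rule bij_betw_cong[THEN iffD1, rotated]) (simp add: g_def)
  ultimately have "bij_betw g (Domain M \<union> (A - Domain M)) (Range M \<union> (B - Range M))"
    by (rule bij_betw_combine) blast
  then have "bij_betw g A B" using D R by (simp add: Un_absorb1)
  then show thesis by (rule that) (use f in \<open>auto simp: g_def\<close>)
qed

lemma card_residue_class_below:
  fixes n p q d :: nat
  assumes "d < q" "q * p \<le> n" "n < q * (p + 1)"
  shows "card {k. k < n \<and> k mod q = d} = p \<or> card {k. k < n \<and> k mod q = d} = p + 1"
proof -
  let ?C = "{k. k < n \<and> k mod q = d}" and ?e = "\<lambda>i. q * i + d"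
  have inj: "inj_on ?e S" for S using assms(1) by (auto simp: inj_on_def)
  have "?e ` {..<p} \<subseteq> ?C"
  proof clarsimp
    fix i assume i: "i < p"
    have "q * i + d < q * (i + 1)" using assms(1) by simp
    also have "\<dots> \<le> q * p" using i by (intro mult_le_mono2) simp
    finally show "q * i + d < n \<and> d mod q = d" using assms by simp
  qed
  then have "p \<le> card ?C"
    using card_mono[of ?C "?e ` {..<p}"] by (simp add: card_image[OF inj])
  moreover have "?C \<subseteq> ?e ` {..<p + 1}"
  proof
    fix k assume k: "k \<in> ?C"
    then have "k = ?e (k div q)" by (auto simp: mult_div_mod_eq)
    moreover have "k div q < p + 1"
      using k assms by (intro less_mult_imp_div_less) (simp add: mult.commute)
    ultimately show "k \<in> ?e ` {..<p + 1}" by blast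
  qed
  then have "card ?C \<le> p + 1"
    using card_mono[of "?e ` {..<p + 1}" ?C] by (simp add: card_image[OF inj])
  ultimately show ?thesis by linarith
qed

section \<open>Colorings of covers of the complete bipartite graph\<close>

lemma dp_cover_arc_projects:
  assumes "dp_cover G L H" "a \<in> pverts G" "b \<in> pverts G" "x \<in> L a" "y \<in> L b" "(x, y) \<in> parcs H"
  shows "(a, b) \<in> parcs G"
proof (rule ccontr)
  assume *: "(a, b) \<notin> parcs G"
  show False
  proof (cases "a = b")
    case True
    then show ?thesis using assms by (auto simp: dp_cover_def indep_set_def)
  next
    case False
    then have "edges_between H (L a) (L b) = {}" using assms * by (simp add: dp_cover_def)
    then show False using assms unfolding edges_between_def by blast
  qed
qed

text \<open>
  The matching between two lists may be partial. Completing it to a bijection \<open>g\<close> can only block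
  more colors, so counting with \<open>g\<close> instead of the arcs of \<open>H\<close> bounds the number of colorings from
  below.
\<close>

lemma dp_cover_matching_bij:
  assumes cov: "dp_fold_cover q G L H" and ab: "a \<in> pverts G" "b \<in> pverts G" "a \<noteq> b"
  obtains g where "bij_betw g (L a) (L b)"
    "\<And>x y. x \<in> L a \<Longrightarrow> y \<in> L b \<Longrightarrow> (x, y) \<in> parcs H \<Longrightarrow> g x = y"
proof -
  have c: "dp_cover G L H" using cov by (simp add: dp_fold_cover_def)
  define M where "M = parcs H \<inter> L a \<times> L b"
  have disj: "L a \<inter> L b = {}" using c ab by (simp add: dp_cover_def disjoint_family_on_def)
  have m: "pairwise disjnt (edges_between H (L a) (L b))"
    using c ab by (simp add: dp_cover_def matching_def)
  have eq: "{x, y} = {x', y'}" if "(x, y) \<in> M" "(x', y') \<in> M" "{x, y} \<inter> {x', y'} \<noteq> {}" for x y x' y'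
  proof -
    have "{x, y} \<in> edges_between H (L a) (L b)" "{x', y'} \<in> edges_between H (L a) (L b)"
      using that(1,2) unfolding edges_between_def M_def by blast+
    then show ?thesis using that(3) pairwiseD[OF m] unfolding disjnt_def by metis
  qed
  have sv: "single_valued M"
  proof (rule single_valuedI)
    fix x y z assume xy: "(x, y) \<in> M" "(x, z) \<in> M"
    then have "{x, y} = {x, z}" by (rule eq) simp
    then show "y = z" by (auto simp: doubleton_eq_iff)
  qed
  have svc: "single_valued (M\<inverse>)"
  proof (rule single_valuedI)
    fix x y z assume "(x, y) \<in> M\<inverse>" "(x, z) \<in> M\<inverse>"
    then have xy: "(y, x) \<in> M" "(z, x) \<in> M" by auto
    then have "{y, x} = {z, x}" by (rule eq) simp
    then show "y = z" by (auto simp: doubleton_eq_iff)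
  qed
  have fin: "finite (L a)" "finite (L b)" "card (L a) = card (L b)"
    using cov ab by (auto simp: dp_fold_cover_def)
  have "M \<subseteq> L a \<times> L b" by (simp add: M_def)
  then obtain g where "bij_betw g (L a) (L b)" "\<And>x y. (x, y) \<in> M \<Longrightarrow> g x = y"
    using matching_extends_to_bij[OF fin _ sv svc] by metis
  then show thesis using that unfolding M_def by blast
qed

definition unblocked :: "'b pair_pre_digraph \<Rightarrow> 'b set \<Rightarrow> 'b \<Rightarrow> 'b \<Rightarrow> 'b set" where
  "unblocked H C s t = {z \<in> C. (s, z) \<notin> parcs H \<and> (t, z) \<notin> parcs H}"

text \<open>
  The arcs of \<open>H\<close> lie over arcs of \<open>G\<close>, hence between the lists of \<open>u\<close> or \<open>v\<close> and those of \<open>Y\<close>. Once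
  the colors of \<open>u\<close> and \<open>v\<close> are chosen, the choices at the vertices of \<open>Y\<close> do not interact.
\<close>

lemma num_dp_colorings_2_n:
  assumes V: "pverts G = {u, v} \<union> Y" and uv: "u \<noteq> v" and uvY: "u \<notin> Y" "v \<notin> Y" and Y: "finite Y"
    and A: "parcs G = {u, v} \<times> Y \<union> Y \<times> {u, v}"
    and cov: "dp_cover G L H"
  shows "num_dp_colorings G L H = (\<Sum>(s, t)\<in>L u \<times> L v. \<Prod>y\<in>Y. card (unblocked H (L y) s t))"
proof -
  interpret H: pair_graph H using cov by (simp add: dp_cover_def)
  have VH: "pverts H = (\<Union>x\<in>pverts G. L x)" using cov by (simp add: dp_cover_def)
  then have sub: "L x \<subseteq> pverts H" if "x \<in> pverts G" for x using that by blast
  have finL: "finite (L x)" if "x \<in> pverts G" for x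
    using sub[OF that] H.pair_finite_verts finite_subset by blast
  have disj: "a = b" if "x \<in> L a" "x \<in> L b" "a \<in> pverts G" "b \<in> pverts G" for a b x
    using that cov by (auto simp: dp_cover_def disjoint_family_on_def)
  have symH: "(y, x) \<in> parcs H" if "(x, y) \<in> parcs H" for x y
    using H.pair_sym_arcs that by (simp add: symmetric_def sym_def)
  let ?X = "SIGMA st:L u \<times> L v. PiE Y (\<lambda>y. unblocked H (L y) (fst st) (snd st))"
  let ?enc = "\<lambda>((s, t), f). {s, t} \<union> f ` Y"
  let ?el = "\<lambda>T x. the_elem (T \<inter> L x)"
  let ?dec = "\<lambda>T. ((?el T u, ?el T v), \<lambda>y\<in>Y. ?el T y)"
  have uV: "u \<in> pverts G" and vV: "v \<in> pverts G" and yV: "\<And>y. y \<in> Y \<Longrightarrow> y \<in> pverts G"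
    by (simp_all add: V)
  have inter: "({s, t} \<union> f ` Y) \<inter> L x = {if x = u then s else if x = v then t else f x}"
    if st: "s \<in> L u" "t \<in> L v" and f: "\<forall>y\<in>Y. f y \<in> L y" and x: "x \<in> pverts G" for s t f x
  proof -
    have "s \<in> L x \<longleftrightarrow> x = u" "t \<in> L x \<longleftrightarrow> x = v"
      using st disj[OF st(1) _ uV x] disj[OF st(2) _ vV x] by blast+
    moreover have "f y \<in> L x \<longleftrightarrow> x = y" if "y \<in> Y" for y
      using f that disj[of "f y" y x] yV x by blast
    moreover have "x = u \<or> x = v \<or> x \<in> Y" using x by (simp add: V)
    ultimately show ?thesis using uv uvY by auto
  qed
  have bij: "bij_betw ?enc ?X (dp_colorings G L H)"
  proof (rule bij_betw_byWitness[where f' = ?dec])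
    show "\<forall>w\<in>?X. ?dec (?enc w) = w"
    proof
      fix w assume "w \<in> ?X"
      then obtain s t f where w: "w = ((s, t), f)" "s \<in> L u" "t \<in> L v"
        "f \<in> PiE Y (\<lambda>y. unblocked H (L y) s t)" by auto
      then have f: "\<forall>y\<in>Y. f y \<in> L y" by (auto simp: unblocked_def PiE_iff)
      have el: "?el ({s, t} \<union> f ` Y) x = (if x = u then s else if x = v then t else f x)"
        if "x \<in> pverts G" for x
        using inter[OF w(2,3) f that] by (simp only: the_elem_eq)
      have "(\<lambda>y\<in>Y. ?el ({s, t} \<union> f ` Y) y) = f"
      proof
        fix y
        show "(\<lambda>y\<in>Y. ?el ({s, t} \<union> f ` Y) y) y = f y"
          using el[OF yV, of y] w(4) uvY by (cases "y \<in> Y") (auto simp: PiE_def extensional_def)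
      qed
      then show "?dec (?enc w) = w"
        using el[OF uV] el[OF vV] uv by (simp add: w(1))
    qed
    have el: "T \<inter> L x = {?el T x}" if "T \<in> dp_colorings G L H" "x \<in> pverts G" for T x
    proof -
      have "card (T \<inter> L x) = 1" using that by (simp add: dp_colorings_def)
      then show ?thesis by (metis card_1_singletonE the_elem_eq)
    qed
    show "\<forall>T\<in>dp_colorings G L H. ?enc (?dec T) = T"
    proof
      fix T assume T: "T \<in> dp_colorings G L H"
      then have "T = (\<Union>x\<in>pverts G. T \<inter> L x)" using VH by (auto simp: dp_colorings_def)
      also have "\<dots> = (\<Union>x\<in>pverts G. {?el T x})" using el[OF T] by blast
      also have "\<dots> = ?enc (?dec T)" by (auto simp: V)
      finally show "?enc (?dec T) = T" by simp
    qed
    show "?enc ` ?X \<subseteq> dp_colorings G L H"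
    proof
      fix T assume "T \<in> ?enc ` ?X"
      then obtain s t f where T: "T = {s, t} \<union> f ` Y" and st: "s \<in> L u" "t \<in> L v"
        and fP: "f \<in> PiE Y (\<lambda>y. unblocked H (L y) s t)" by auto
      have f: "\<forall>y\<in>Y. f y \<in> L y"
        and nb: "\<And>y. y \<in> Y \<Longrightarrow> (s, f y) \<notin> parcs H \<and> (t, f y) \<notin> parcs H"
        using fP by (auto simp: unblocked_def PiE_iff)
      have TV: "T \<subseteq> pverts H" using st f by (auto simp: T VH V)
      have un: "x \<in> L w \<Longrightarrow> x \<in> T \<Longrightarrow> w \<in> pverts G \<Longrightarrow>
          x = (if w = u then s else if w = v then t else f w)" for x w
        using inter[OF st f, of w] unfolding T by blast
      have no: "(x, y) \<notin> parcs H" if xy: "x \<in> T" "y \<in> T" for x y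
      proof
        assume arc: "(x, y) \<in> parcs H"
        from xy TV VH obtain a b where ab: "a \<in> pverts G" "b \<in> pverts G" "x \<in> L a" "y \<in> L b" by blast
        have "(a, b) \<in> parcs G" using dp_cover_arc_projects[OF cov ab arc] .
        then show False
          using un[OF ab(3) xy(1) ab(1)] un[OF ab(4) xy(2) ab(2)] nb arc symH[OF arc] uv uvY
          by (auto simp: A split: if_splits)
      qed
      have "card (T \<inter> L x) = 1" if "x \<in> pverts G" for x
        unfolding T inter[OF st f that] by simp
      then show "T \<in> dp_colorings G L H" using TV no by (simp add: dp_colorings_def indep_set_def)
    qed
    show "?dec ` dp_colorings G L H \<subseteq> ?X"
    proof
      fix w assume "w \<in> ?dec ` dp_colorings G L H"
      then obtain T where w: "w = ?dec T" and T: "T \<in> dp_colorings G L H" by blast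
      have "?el T x \<in> T \<inter> L x" if "x \<in> pverts G" for x using el[OF T that] by blast
      then have e: "?el T x \<in> T" "?el T x \<in> L x" if "x \<in> pverts G" for x using that by blast+
      have "indep_set H T" using T by (simp add: dp_colorings_def)
      then have "(?el T x, ?el T y) \<notin> parcs H" if "x \<in> pverts G" "y \<in> pverts G" for x y
        using e(1) that unfolding indep_set_def by blast
      then show "w \<in> ?X" using e(2) by (simp add: w V unblocked_def)
    qed
  qed
  have fin: "finite (L u \<times> L v)" using finL by (simp add: V)
  have "finite (unblocked H (L y) s t)" if "y \<in> Y" for y s t
    using finL[of y] that by (simp add: V unblocked_def)
  then have "card ?X = (\<Sum>st\<in>L u \<times> L v. \<Prod>y\<in>Y. card (unblocked H (L y) (fst st) (snd st)))"
    using fin Y by (subst card_SigmaI) (auto intro!: finite_PiE simp: card_PiE)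
  then show ?thesis
    using bij_betw_same_card[OF bij] by (simp add: num_dp_colorings_def case_prod_unfold)
qed

section \<open>Agreements between two families of bijections\<close>

definition agreements :: "'y set \<Rightarrow> ('y \<Rightarrow> 'a \<Rightarrow> 'c) \<Rightarrow> ('y \<Rightarrow> 'b \<Rightarrow> 'c) \<Rightarrow> 'a \<times> 'b \<Rightarrow> nat" where
  "agreements Y g h st = card {y \<in> Y. g y (fst st) = h y (snd st)}"

text \<open>
  Double counting: for a fixed \<open>y\<close> the pairs in agreement form the graph of the bijection
  \<open>(h y)\<inverse> \<circ> g y\<close> and so there are \<open>q\<close> of them.
\<close>

lemma sum_agreements:
  assumes "finite Y" "finite A" "finite B" "card A = q"
    and g: "\<And>y. y \<in> Y \<Longrightarrow> bij_betw (g y) A (C y)" and h: "\<And>y. y \<in> Y \<Longrightarrow> bij_betw (h y) B (C y)"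
  shows "(\<Sum>st\<in>A \<times> B. agreements Y g h st) = q * card Y"
proof -
  have one: "card {st \<in> A \<times> B. g y (fst st) = h y (snd st)} = q" if y: "y \<in> Y" for y
  proof -
    let ?P = "{st \<in> A \<times> B. g y (fst st) = h y (snd st)}"
    have "bij_betw (\<lambda>s. (s, inv_into B (h y) (g y s))) A ?P"
    proof (rule bij_betw_byWitness[where f' = fst])
      have "h y ` B = g y ` A"
        using bij_betw_imp_surj_on[OF g[OF y]] bij_betw_imp_surj_on[OF h[OF y]] by simp
      then have "g y s \<in> h y ` B" if "s \<in> A" for s
        using that by blast
      then show "(\<lambda>s. (s, inv_into B (h y) (g y s))) ` A \<subseteq> ?P"
        by (auto simp: f_inv_into_f inv_into_into)
      show "\<forall>st\<in>?P. (fst st, inv_into B (h y) (g y (fst st))) = st"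
        using bij_betw_imp_inj_on[OF h[OF y]] by auto
    qed auto
    from bij_betw_same_card[OF this] show ?thesis using assms(4) by simp
  qed
  have "(\<Sum>st\<in>A \<times> B. agreements Y g h st)
      = (\<Sum>st\<in>A \<times> B. \<Sum>y\<in>Y. if g y (fst st) = h y (snd st) then 1 else 0)"
    unfolding agreements_def card_eq_sum sum.inter_filter[OF assms(1)] ..
  also have "\<dots> = (\<Sum>y\<in>Y. \<Sum>st\<in>A \<times> B. if g y (fst st) = h y (snd st) then 1 else 0)"
    by (rule sum.swap)
  also have "\<dots> = (\<Sum>y\<in>Y. card {st \<in> A \<times> B. g y (fst st) = h y (snd st)})"
    unfolding card_eq_sum sum.inter_filter[OF finite_cartesian_product[OF assms(2,3)]] ..
  also have "\<dots> = q * card Y" using one by simp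
  finally show ?thesis .
qed

lemma prod_agreements:
  fixes x z :: int
  assumes "finite Y"
  shows "(\<Prod>y\<in>Y. if g y s = h y t then x else z)
    = x ^ agreements Y g h (s, t) * z ^ (card Y - agreements Y g h (s, t))"
proof -
  have "card (Y \<inter> - {y. g y s = h y t}) = card Y - card (Y \<inter> {y. g y s = h y t})"
    using assms by (metis Diff_eq card_Diff_subset_Int finite_Int)
  then show ?thesis using assms by (simp add: agreements_def prod.If_cases Collect_conj_eq)
qed

lemma card_remove_two:
  assumes "finite C" "x \<in> C" "y \<in> C"
  shows "int (card (C - {x, y})) = (if x = y then int (card C) - 1 else int (card C) - 2)"
proof -
  have "int (card (C - {x, y})) = int (card C) - int (card {x, y})"
    using assms by (subst card_Diff_subset) (auto intro!: of_nat_diff card_mono)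
  then show ?thesis by (auto simp: card_insert_if)
qed


text \<open>
  The number of ways to color \<open>Y\<close> after a choice of colors for \<open>u\<close> and \<open>v\<close> that agree at \<open>k\<close> of its
  \<open>n\<close> vertices. The values are integers because \<open>q - 2\<close> is negative for \<open>q = 1\<close>, where only \<open>k = n\<close>
  occurs.
\<close>

definition weight :: "nat \<Rightarrow> nat \<Rightarrow> nat \<Rightarrow> int" where
  "weight q n k = (int q - 1) ^ k * (int q - 2) ^ (n - k)"

lemma prod_card_two_removed:
  assumes "finite Y" "\<And>y. y \<in> Y \<Longrightarrow> finite (C y) \<and> card (C y) = q"
    and "\<And>y. y \<in> Y \<Longrightarrow> g y s \<in> C y" "\<And>y. y \<in> Y \<Longrightarrow> h y t \<in> C y"
  shows "int (\<Prod>y\<in>Y. card (C y - {g y s, h y t})) = weight q (card Y) (agreements Y g h (s, t))"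
proof -
  have "int (\<Prod>y\<in>Y. card (C y - {g y s, h y t})) = (\<Prod>y\<in>Y. if g y s = h y t then int q - 1 else int q - 2)"
    unfolding of_nat_prod using assms by (intro prod.cong) (simp_all add: card_remove_two)
  then show ?thesis using prod_agreements[OF assms(1)] by (simp add: weight_def)
qed

section \<open>Lower bound for an arbitrary cover\<close>

lemma num_dp_colorings_2_n_ge:
  assumes V: "pverts G = {u, v} \<union> Y" and uv: "u \<noteq> v" and uvY: "u \<notin> Y" "v \<notin> Y" and Y: "finite Y"
    and A: "parcs G = {u, v} \<times> Y \<union> Y \<times> {u, v}"
    and cov: "dp_fold_cover q G L H"
  obtains g h where "\<And>y. y \<in> Y \<Longrightarrow> bij_betw (g y) (L u) (L y)"
    "\<And>y. y \<in> Y \<Longrightarrow> bij_betw (h y) (L v) (L y)"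
    "(\<Sum>st\<in>L u \<times> L v. weight q (card Y) (agreements Y g h st)) \<le> int (num_dp_colorings G L H)"
proof -
  have bijections: "\<exists>g. \<forall>y\<in>Y. bij_betw (g y) (L w) (L y) \<and>
      (\<forall>x\<in>L w. \<forall>z\<in>L y. (x, z) \<in> parcs H \<longrightarrow> g y x = z)" if w: "w \<in> {u, v}" for w
  proof (rule bchoice, rule ballI)
    fix y assume "y \<in> Y"
    then have "w \<in> pverts G" "y \<in> pverts G" "w \<noteq> y" using w V uvY by auto
    then show "\<exists>g. bij_betw g (L w) (L y) \<and> (\<forall>x\<in>L w. \<forall>z\<in>L y. (x, z) \<in> parcs H \<longrightarrow> g x = z)"
      by (rule dp_cover_matching_bij[OF cov]) blast
  qed
  obtain g where g: "\<And>y. y \<in> Y \<Longrightarrow> bij_betw (g y) (L u) (L y)"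
    "\<And>y x z. y \<in> Y \<Longrightarrow> x \<in> L u \<Longrightarrow> z \<in> L y \<Longrightarrow> (x, z) \<in> parcs H \<Longrightarrow> g y x = z"
    using bijections[of u] by blast
  obtain h where h: "\<And>y. y \<in> Y \<Longrightarrow> bij_betw (h y) (L v) (L y)"
    "\<And>y x z. y \<in> Y \<Longrightarrow> x \<in> L v \<Longrightarrow> z \<in> L y \<Longrightarrow> (x, z) \<in> parcs H \<Longrightarrow> h y x = z"
    using bijections[of v] by blast
  have c: "dp_cover G L H" and fin: "\<And>x. x \<in> pverts G \<Longrightarrow> finite (L x) \<and> card (L x) = q"
    using cov by (auto simp: dp_fold_cover_def)
  have "(\<Sum>st\<in>L u \<times> L v. weight q (card Y) (agreements Y g h st))
      \<le> (\<Sum>st\<in>L u \<times> L v. int (\<Prod>y\<in>Y. card (unblocked H (L y) (fst st) (snd st))))"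
  proof (rule sum_mono)
    fix st assume "st \<in> L u \<times> L v"
    then obtain s t where st: "st = (s, t)" "s \<in> L u" "t \<in> L v" by auto
    have "weight q (card Y) (agreements Y g h st) = int (\<Prod>y\<in>Y. card (L y - {g y s, h y t}))"
      unfolding st(1)
    proof (rule prod_card_two_removed[OF Y, symmetric])
      fix y assume y: "y \<in> Y"
      show "finite (L y) \<and> card (L y) = q" using fin y by (simp add: V)
      show "g y s \<in> L y" "h y t \<in> L y"
        using bij_betwE[OF g(1)[OF y]] bij_betwE[OF h(1)[OF y]] st by auto
    qed
    also have "\<dots> \<le> int (\<Prod>y\<in>Y. card (unblocked H (L y) s t))"
    proof -
      have "card (L y - {g y s, h y t}) \<le> card (unblocked H (L y) s t)" if y: "y \<in> Y" for y
      proof (rule card_mono)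
        show "finite (unblocked H (L y) s t)" using fin[of y] y by (simp add: V unblocked_def)
        show "L y - {g y s, h y t} \<subseteq> unblocked H (L y) s t"
          using g(2)[OF y st(2)] h(2)[OF y st(3)] by (auto simp: unblocked_def)
      qed
      then show ?thesis unfolding of_nat_le_iff by (intro prod_mono) simp
    qed
    finally show "weight q (card Y) (agreements Y g h st)
      \<le> int (\<Prod>y\<in>Y. card (unblocked H (L y) (fst st) (snd st)))" by (simp add: st(1))
  qed
  also have "\<dots> = int (num_dp_colorings G L H)"
    unfolding num_dp_colorings_2_n[OF V uv uvY Y A c] by (simp add: case_prod_unfold)
  finally show thesis using that g(1) h(1) by blast
qed

section \<open>Covers given by permutations\<close>

lemma matching_edges_betweenI:
  assumes "S \<inter> U = {}"
    and "\<And>x y x' y'. x \<in> S \<Longrightarrow> y \<in> U \<Longrightarrow> (x, y) \<in> parcs H \<Longrightarrow>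
      x' \<in> S \<Longrightarrow> y' \<in> U \<Longrightarrow> (x', y') \<in> parcs H \<Longrightarrow> x = x' \<longleftrightarrow> y = y'"
  shows "matching (edges_between H S U)"
  unfolding matching_def
proof (rule pairwiseI)
  fix d e assume "d \<in> edges_between H S U" "e \<in> edges_between H S U" "d \<noteq> e"
  then obtain x y x' y' where *: "d = {x, y}" "e = {x', y'}" "x \<in> S" "y \<in> U" "(x, y) \<in> parcs H"
    "x' \<in> S" "y' \<in> U" "(x', y') \<in> parcs H"
    unfolding edges_between_def by blast
  then have "x = x' \<longleftrightarrow> y = y'" using assms(2) by blast
  then have "x \<noteq> x'" "y \<noteq> y'" using \<open>d \<noteq> e\<close> * by auto
  moreover have "x \<noteq> y'" "y \<noteq> x'" using * assms(1) by auto
  ultimately show "disjnt d e" by (auto simp: disjnt_def *)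
qed

text \<open>
  All lists are copies of \<open>{..<q}\<close>, and all matchings are perfect, so the colors blocked at \<open>y\<close> are
  exactly \<open>g y i\<close> and \<open>h y j\<close> and the inequality of \<open>num_dp_colorings_2_n_ge\<close> becomes an equality.
\<close>

lemma permutation_cover_2_n:
  fixes G :: "'a pair_pre_digraph"
  assumes V: "pverts G = {u, v} \<union> Y" and uv: "u \<noteq> v" and uvY: "u \<notin> Y" "v \<notin> Y" and Y: "finite Y"
    and A: "parcs G = {u, v} \<times> Y \<union> Y \<times> {u, v}"
    and g: "\<And>y. y \<in> Y \<Longrightarrow> bij_betw (g y) {..<q} {..<q}"
    and h: "\<And>y. y \<in> Y \<Longrightarrow> bij_betw (h y) {..<q} {..<q}"
  obtains L :: "'a \<Rightarrow> ('a \<times> nat) set" and H where "dp_fold_cover q G L H"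
    "int (num_dp_colorings G L H) = (\<Sum>st\<in>{..<q} \<times> {..<q}. weight q (card Y) (agreements Y g h st))"
proof -
  define R where "R = (\<lambda>a i b j. b \<in> Y \<and> (a = u \<and> j = g b i \<or> a = v \<and> j = h b i))"
  \<comment> \<open>\<open>R\<close> directs each arc towards \<open>Y\<close>; the arc set of \<open>H\<close> is its symmetric closure.\<close>
  define H where "H = \<lparr>pverts = pverts G \<times> {..<q},
    parcs = {((a, i), (b, j)) | a i b j. i < q \<and> j < q \<and> (R a i b j \<or> R b j a i)}\<rparr>"
  define L where "L = (\<lambda>a :: 'a. {a} \<times> {..<q})"
  have VH: "pverts H = pverts G \<times> {..<q}" by (simp add: H_def)
  have arc: "((a, i), (b, j)) \<in> parcs H \<longleftrightarrow> i < q \<and> j < q \<and> (R a i b j \<or> R b j a i)" for a i b j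
    by (simp add: H_def)
  have RG: "a \<in> {u, v}" "b \<in> Y" if "R a i b j" for a i b j using that by (auto simp: R_def)
  have RV: "a \<in> pverts G" "b \<in> pverts G" "a \<noteq> b" if "R a i b j" for a i b j
    using RG[OF that] uvY by (auto simp: V)
  have R1: "i = i' \<longleftrightarrow> j = j'" if "R a i b j" "R a i' b j'" "i < q" "i' < q" for a i b j i' j'
  proof -
    have b: "b \<in> Y" using that by (simp add: R_def)
    have "inj_on (g b) {..<q}" "inj_on (h b) {..<q}" using g[OF b] h[OF b] by (auto simp: bij_betw_def)
    then show ?thesis using that uv by (auto simp: R_def inj_on_eq_iff)
  qed
  have graph: "pair_graph H"
  proof
    show "finite (pverts H)" by (simp add: VH V Y)
    have sub: "parcs H \<subseteq> pverts H \<times> pverts H" using RV by (auto simp: VH arc)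
    then show "finite (parcs H)"
      using \<open>finite (pverts H)\<close> finite_subset finite_cartesian_product by metis
    show "symmetric (with_proj H)" unfolding symmetric_def with_proj_simps
      by (rule symI) (auto simp: arc)
    fix e assume e: "e \<in> parcs H"
    then show "fst e \<in> pverts H" "snd e \<in> pverts H" using sub by auto
    obtain a i b j where "e = ((a, i), (b, j))" by (metis prod.exhaust)
    then show "fst e \<noteq> snd e" using e RV(3) by (auto simp: arc)
  qed
  have cov: "dp_cover G L H"
    unfolding dp_cover_def
  proof (intro conjI ballI impI graph)
    show "disjoint_family_on L (pverts G)" by (auto simp: L_def disjoint_family_on_def)
    show "pverts H = (\<Union>x\<in>pverts G. L x)" by (auto simp: VH L_def)
    show "indep_set H (L x)" if "x \<in> pverts G" for x
      using that RV(3) by (auto simp: indep_set_def L_def VH arc)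
    fix a b assume ab: "a \<in> pverts G" "b \<in> pverts G" "a \<noteq> b"
    show "matching (edges_between H (L a) (L b))"
    proof (rule matching_edges_betweenI)
      show "L a \<inter> L b = {}" using ab by (auto simp: L_def)
      fix x y x' y'
      assume "x \<in> L a" "y \<in> L b" "(x, y) \<in> parcs H" "x' \<in> L a" "y' \<in> L b" "(x', y') \<in> parcs H"
      then obtain i j i' j' where *: "x = (a, i)" "y = (b, j)" "x' = (a, i')" "y' = (b, j')"
        "i < q" "j < q" "i' < q" "j' < q" "R a i b j \<or> R b j a i" "R a i' b j' \<or> R b j' a i'"
        by (auto simp: L_def arc)
      \<comment> \<open>Both edges have the same orientation, as only one of \<open>a\<close> and \<open>b\<close> is in \<open>Y\<close>.\<close>
      have "\<not> (R a k b l \<and> R b k' a l')" for k l k' l' using RG uvY by blast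
      then consider "R a i b j" "R a i' b j'" | "R b j a i" "R b j' a i'" using *(9,10) by blast
      then have "i = i' \<longleftrightarrow> j = j'"
        by cases (use R1 *(5-8) in blast)+
      then show "x = x' \<longleftrightarrow> y = y'" by (simp add: *)
    qed
    show "edges_between H (L a) (L b) = {}" if "(a, b) \<notin> parcs G"
    proof -
      have "\<not> R a i b j \<and> \<not> R b j a i" for i j using that RG unfolding A by blast
      then show ?thesis by (auto simp: edges_between_def L_def arc)
    qed
  qed
  have L: "finite (L x) \<and> card (L x) = q" for x by (simp add: L_def)
  then have fold: "dp_fold_cover q G L H" using cov by (simp add: dp_fold_cover_def)
  have unb: "unblocked H (L y) (u, i) (v, j) = L y - {(y, g y i), (y, h y j)}"
    if "y \<in> Y" "i < q" "j < q" for y i j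
    using that uv uvY by (auto simp: unblocked_def L_def arc R_def)
  have wt: "int (\<Prod>y\<in>Y. card (unblocked H (L y) (u, i) (v, j))) = weight q (card Y) (agreements Y g h (i, j))"
    if ij: "i < q" "j < q" for i j
  proof -
    have "g y i < q" "h y j < q" if "y \<in> Y" for y
      using bij_betwE[OF g[OF that]] bij_betwE[OF h[OF that]] ij by auto
    then have "int (\<Prod>y\<in>Y. card (L y - {(y, g y i), (y, h y j)}))
        = weight q (card Y) (agreements Y (\<lambda>y i. (y, g y i)) (\<lambda>y j. (y, h y j)) (i, j))"
      by (intro prod_card_two_removed[OF Y L, where g = "\<lambda>y i. (y, g y i)" and h = "\<lambda>y j. (y, h y j)"])
        (simp_all add: L_def)
    then show ?thesis using unb[OF _ ij] by (simp add: agreements_def)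
  qed
  have "L u \<times> L v = (\<lambda>(i, j). ((u, i), (v, j))) ` ({..<q} \<times> {..<q})"
    by (auto simp: L_def image_iff)
  moreover have "inj_on (\<lambda>(i, j). ((u, i), (v, j))) ({..<q} \<times> {..<q})"
    by (auto simp: inj_on_def)
  ultimately have "num_dp_colorings G L H
      = (\<Sum>(i, j)\<in>{..<q} \<times> {..<q}. \<Prod>y\<in>Y. card (unblocked H (L y) (u, i) (v, j)))"
    unfolding num_dp_colorings_2_n[OF V uv uvY Y A cov] by (simp add: sum.reindex case_prod_unfold)
  also have "int \<dots> = (\<Sum>st\<in>{..<q} \<times> {..<q}. weight q (card Y) (agreements Y g h st))"
    unfolding of_nat_sum case_prod_unfold by (rule sum.cong) (use wt in auto)
  finally show thesis using that fold by blast
qed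

section \<open>The value of the DP color function\<close>

lemma bij_betw_add_mod: "bij_betw (\<lambda>j. (j + k) mod q) {..<q} {..<q :: nat}"
proof (cases "q = 0")
  case False
  have "inj_on (\<lambda>j. (j + k) mod q) {..<q}"
  proof (rule linorder_inj_onI)
    fix i j :: nat assume ij: "i < j" "i \<in> {..<q}" "j \<in> {..<q}"
    then have "\<not> q dvd (j + k) - (i + k)" by (auto dest: dvd_imp_le)
    then show "(i + k) mod q \<noteq> (j + k) mod q"
      using mod_eq_dvd_iff_nat[of "i + k" "j + k" q] ij by auto
  qed auto
  moreover have "(\<lambda>j. (j + k) mod q) ` {..<q} \<subseteq> {..<q}" using False by auto
  ultimately show ?thesis by (simp add: bij_betw_def endo_inj_surj)
qed (simp add: bij_betw_def)

lemma card_shift_agreements: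
  fixes n p q i j :: nat
  assumes "i < q" "j < q" "q * p \<le> n" "n < q * (p + 1)"
  shows "card {k. k < n \<and> i = (j + k) mod q} = p \<or> card {k. k < n \<and> i = (j + k) mod q} = p + 1"
proof -
  have "i = (j + k) mod q \<longleftrightarrow> k mod q = (i + (q - j)) mod q" for k
  proof
    assume "i = (j + k) mod q"
    then have "(i + (q - j)) mod q = (j + k + (q - j)) mod q" by (simp add: mod_add_left_eq)
    also have "j + k + (q - j) = k + q" using assms by simp
    finally show "k mod q = (i + (q - j)) mod q" by simp
  next
    assume "k mod q = (i + (q - j)) mod q"
    then have "(j + k) mod q = (j + (i + (q - j))) mod q" by (metis mod_add_right_eq)
    also have "j + (i + (q - j)) = i + q" using assms by simp
    finally show "i = (j + k) mod q" using assms by simp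
  qed
  then show ?thesis using card_residue_class_below[of "(i + (q - j)) mod q" q p n] assms by simp
qed

text \<open>
  The right-hand side is the sum over all \<open>q\<^sup>2\<close> pairs of the line through the values of the weight
  at \<open>p\<close> and \<open>p + 1\<close>. Rotations give a cover that attains it, and convexity of the weight shows
  that no cover has fewer colorings.
\<close>

lemma dp_color_function_2_n:
  assumes q: "q \<ge> 1" and n: "n \<ge> 1" and r: "q * n = q\<^sup>2 * p + r" and p: "q * p \<le> n" "n < q * (p + 1)"
    and K: "K\<^bsub>2,n\<^esub> (with_proj G)"
  shows "int (dp_color_function G q)
    = int (q\<^sup>2) * weight q n p + int r * (weight q n (p + 1) - weight q n p)" (is "_ = ?rhs")
proof -
  obtain U Y where UY: "pverts G = U \<union> Y" "U \<inter> Y = {}" "card U = 2" "card Y = n"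
    "parcs G = U \<times> Y \<union> Y \<times> U" and finV: "finite (pverts G)"
    using K unfolding complete_bipartite_digraph_pair_def by blast
  obtain u v where U: "U = {u, v}" "u \<noteq> v" using UY(3) by (auto simp: card_2_iff)
  have V: "pverts G = {u, v} \<union> Y" and uv: "u \<noteq> v" and uvY: "u \<notin> Y" "v \<notin> Y" and Y: "finite Y"
    and A: "parcs G = {u, v} \<times> Y \<union> Y \<times> {u, v}"
    using UY U finV by auto
  show ?thesis
  proof (rule antisym)
    obtain idx where idx: "bij_betw idx Y {..<n}"
      using Y UY(4) finite_same_card_bij[of Y "{..<n}"] by auto
    let ?g = "\<lambda>(y :: 'a) (i :: nat). i" and ?h = "\<lambda>y j. (j + idx y) mod q"
    let ?I = "{..<q} \<times> {..<q}"
    have bij: "bij_betw (?g y) {..<q} {..<q}" "bij_betw (?h y) {..<q} {..<q}" for y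
      using bij_betw_add_mod by (auto simp: bij_betw_def inj_on_def)
    obtain L :: "'a \<Rightarrow> ('a \<times> nat) set" and H where LH: "dp_fold_cover q G L H"
      "int (num_dp_colorings G L H) = (\<Sum>st\<in>?I. weight q n (agreements Y ?g ?h st))"
      using permutation_cover_2_n[OF V uv uvY Y A bij] unfolding UY(4) .
    have "agreements Y ?g ?h st = p \<or> agreements Y ?g ?h st = p + 1" if st: "st \<in> ?I" for st
    proof -
      obtain i j where ij: "st = (i, j)" "i < q" "j < q" using st by auto
      have "bij_betw idx {y \<in> Y. i = (j + idx y) mod q} {k \<in> {..<n}. i = (j + k) mod q}"
        by (rule bij_betw_Collect[OF idx]) simp
      then have "agreements Y ?g ?h st = card {k. k < n \<and> i = (j + k) mod q}"
        by (simp add: agreements_def ij bij_betw_same_card)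
      then show ?thesis using card_shift_agreements[OF ij(2,3) p] by simp
    qed
    moreover have "(\<Sum>st\<in>?I. agreements Y ?g ?h st) = card ?I * p + r"
      using sum_agreements[OF Y, of "{..<q}" "{..<q}" q ?g "\<lambda>_. {..<q}" ?h] bij UY(4) r
      by (simp add: power2_eq_square)
    ultimately have "int (num_dp_colorings G L H) = ?rhs"
      unfolding LH(2) by (subst sum_of_two_consecutive_values[where p = p and r = r]) (simp_all add: power2_eq_square)
    then show "int (dp_color_function G q) \<le> ?rhs" using dp_color_function_le[OF LH(1)] by linarith
  next
    show "?rhs \<le> int (dp_color_function G q)"
    proof (cases "q = 1")
      case True
      \<comment> \<open>The weight need not be convex here, but the bound is \<open>weight 1 n n = 0 ^ n\<close>.\<close>
      then have "p = n" "r = 0" using p r by auto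
      then show ?thesis using True n by (simp add: weight_def zero_power)
    next
      case False
      then have q2: "q \<ge> 2" using q by simp
      have pn: "p < n"
      proof (rule ccontr)
        assume "\<not> p < n"
        then have "q * n \<le> n" using p(1) by (meson le_trans mult_le_mono2 not_le)
        then show False using q2 n by simp
      qed
      have "pair_graph G" using K by (rule pair_graphI_complete_bipartite)
      then obtain L :: "'a \<Rightarrow> nat set" and H where LH: "dp_fold_cover q G L H"
        "dp_color_function G q = num_dp_colorings G L H"
        by (rule dp_color_function_attained)
      obtain g h where gh: "\<And>y. y \<in> Y \<Longrightarrow> bij_betw (g y) (L u) (L y)"
          "\<And>y. y \<in> Y \<Longrightarrow> bij_betw (h y) (L v) (L y)"
        and le: "(\<Sum>st\<in>L u \<times> L v. weight q n (agreements Y g h st)) \<le> int (num_dp_colorings G L H)"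
        using num_dp_colorings_2_n_ge[OF V uv uvY Y A LH(1)] UY(4) by metis
      have fin: "finite (L u)" "finite (L v)" "card (L u) = q" "card (L v) = q"
        using LH(1) by (auto simp: dp_fold_cover_def V)
      let ?D = "weight q n (p + 1) - weight q n p"
      have sum: "(\<Sum>st\<in>L u \<times> L v. agreements Y g h st) = q * n"
        using sum_agreements[OF Y fin(1-3) gh] UY(4) by simp
      have "?rhs = int (q\<^sup>2) * weight q n p + (int (q * n) - int (q\<^sup>2) * int p) * ?D"
        unfolding r by simp
      also have "\<dots> = (\<Sum>st\<in>L u \<times> L v. weight q n p + (int (agreements Y g h st) - int p) * ?D)"
        unfolding sum[symmetric] using fin
        by (simp add: sum.distrib sum_subtractf card_cartesian_product power2_eq_square flip: sum_distrib_right)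
      also have "\<dots> \<le> (\<Sum>st\<in>L u \<times> L v. weight q n (agreements Y g h st))"
      proof (intro sum_mono convex_sequence_above_tangent[OF _ pn])
        fix k assume "k + 2 \<le> n"
        then show "weight q n (k + 1) - weight q n k \<le> weight q n (k + 2) - weight q n (k + 1)"
          using power_split_convex[of "int q - 2" k n] q2 by (simp add: weight_def)
      next
        fix st show "agreements Y g h st \<le> n"
          unfolding agreements_def UY(4)[symmetric] using Y by (intro card_mono) auto
      qed
      finally show ?thesis using le LH(2) by linarith
    qed
  qed
qed

theorem theorem5:
  fixes q n p r :: nat and a :: "nat \<Rightarrow> nat" and G :: "'a pair_pre_digraph"
  assumes "q \<ge> 1" and "n \<ge> 1"
    and "q * n = q\<^sup>2 * p + r"
    and "int p = \<lfloor>real n / real q\<rfloor>"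
    and "\<And>j. j \<in> {1..q\<^sup>2} \<Longrightarrow> a j = (if j \<le> r then p + 1 else p)"
    and "K\<^bsub>2,n\<^esub> (with_proj G)"
  shows "int (dp_color_function G q) =
    (\<Sum>i=1..q\<^sup>2. (int q - 1) ^ a i * (int q - 2) ^ (n - a i))"
proof -
  have "int p = int (n div q)" using assms(4) by (simp add: floor_divide_of_nat_eq)
  then have p: "p = n div q" by simp
  have p1: "q * p \<le> n" and p2: "n < q * (p + 1)"
    using assms(1) dividend_less_times_div[of q n] by (simp_all add: p)
  have "q * n < q * (q * (p + 1))" using p2 assms(1) by simp
  then have r: "r \<le> q\<^sup>2" using assms(3) by (simp add: power2_eq_square algebra_simps)
  have "(\<Sum>i=1..q\<^sup>2. a i) = (\<Sum>i=1..q\<^sup>2. p + (if i \<le> r then 1 else 0))"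
    using assms(5) by (intro sum.cong) auto
  also have "\<dots> = q\<^sup>2 * p + card {i \<in> {1..q\<^sup>2}. i \<le> r}"
    by (simp add: sum.distrib sum.inter_filter[symmetric])
  also have "{i \<in> {1..q\<^sup>2}. i \<le> r} = {1..r}" using r by auto
  finally have "(\<Sum>i=1..q\<^sup>2. a i) = card {1..q\<^sup>2} * p + r" by simp
  then have "(\<Sum>i=1..q\<^sup>2. weight q n (a i))
      = int (q\<^sup>2) * weight q n p + int r * (weight q n (p + 1) - weight q n p)"
    using assms(5) by (subst sum_of_two_consecutive_values[where p = p and r = r]) auto
  then show ?thesis
    using dp_color_function_2_n[OF assms(1-3) p1 p2 assms(6)] by (simp add: weight_def)
qed

end
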